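(* Let $Q=(F,+,\circ)$ be a prequasifield with transpose $Q^t=(F,+,\star)$, and let $G:F\to F$ be a function. Define $f:F\times F\to\mathbb{F}_2$ by $f(0,y)=0$ for all $y\in F$ and, for $x\neq0$, $f(x,y)=tr(G(z)x)$ where $z\in F$ is the unique element with $x\circ z=y$. Then the following are equivalent: (1) $f$ is bent; (2) $G$ is a bijection and, for every $b\in F^*$, the map $z\mapsto G(z)+b\star z$ is 2-to-1 (every element of $F$ has either $0$ or $2$ preimages); (3) $\mathcal{O}=\{x=0\}\cup\{y=G(z)+x\star z: z\in F\}$ is a line oval in $\mathcal{A}(Q^t)$. In this case the dual of $f$ is $\tilde f(x,y)=1+\chi_{E(\mathcal{O})}(y,x)$, i.e. $\tilde f(x,y)=0$ if $(y,x)\in E(\mathcal{O})$ and $1$ otherwise; moreover $$\tilde f(x,y)=y^{q-1}\prod_{z\in F}\bigl(y\star z+x+G(z)\bigr)^{q-1}.$$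
   Context: Let $m\ge1$, $q=2^m$, $F=\mathbb{F}_q$, $tr:F\to\mathbb{F}_2$ the absolute trace. A (right) prequasifield $Q=(F,+,\circ)$ is $F$ with its field addition and a multiplication $\circ$ such that $(F\setminus\{0\},\circ)$ is a quasigroup, $(x+y)\circ z=x\circ z+y\circ z$ and $x\circ0=0$ for all $x,y,z$. Its transpose $Q^t=(F,+,\star)$ is defined by $tr((x\star z)y)=tr(x(y\circ z))$ for all $x,y,z\in F$. The affine plane $\mathcal{A}(Q^t)$ has point set $F\times F$ and lines $\{x=c\}=\{(c,y):y\in F\}$ and $\{y=x\star b+a\}=\{(x,x\star b+a):x\in F\}$, $a,b,c\in F$; lines $x=c$ are mutually parallel, and lines $y=x\star b+a$ with the same $b$ are mutually parallel. A line oval in $\mathcal{A}(Q^t)$ is a set of $q+1$ lines, no two parallel and no three through a common point (equivalently, extended to the projective completion, a line oval whose nucleus is the line at infinity). $E(\mathcal{O})$ is the set of points on at least one line of $\mathcal{O}$. $f:F\times F\to\mathbb{F}_2$ is bent if $W_f(a,b)=\sum_{x,y\in F}(-1)^{f(x,y)+tr(ax+by)}=\pm q$ for all $a,b$, with dual defined by $W_f(a,b)=(-1)^{\tilde f(a,b)}q$. In the product formula the right-hand side lies in $\{0,1\}\subseteq F$, identified with $\mathbb{F}_2$. *)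

theory Defs
  imports
    "HOL-Number_Theory.Number_Theory"
    "HOL-Computational_Algebra.Polynomial"
    "HOL-Library.Cardinality"
    "HOL-Library.Z2"
    "HOL-Library.Indicator_Function"
begin

text \<open>
  The field \<open>F\<close> with \<open>q = 2 ^ m\<close> elements is a type \<open>'a :: finite_field\<close> with
  \<open>CARD('a) = 2 ^ m\<close>; the exponent \<open>m\<close> is passed explicitly to the notions that use the
  trace. The prime field is the type \<open>bit\<close>, and \<open>of_bit\<close> is its embedding into \<open>F\<close>.
\<close>

definition abs_trace :: "nat \<Rightarrow> 'a :: finite_field \<Rightarrow> bit" where
  "abs_trace m x = (THE t. of_bit t = (\<Sum>i<m. x ^ (2 ^ i)))"


subsection \<open>Prequasifields and their transposes\<close>

definition quasigroup_on :: "'a set \<Rightarrow> ('a \<Rightarrow> 'a \<Rightarrow> 'a) \<Rightarrow> bool" where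
  "quasigroup_on S f \<longleftrightarrow>
     (\<forall>x\<in>S. \<forall>y\<in>S. f x y \<in> S) \<and>
     (\<forall>a\<in>S. \<forall>b\<in>S. (\<exists>!x. x \<in> S \<and> f a x = b) \<and> (\<exists>!y. y \<in> S \<and> f y a = b))"

definition right_prequasifield :: "('a :: field \<Rightarrow> 'a \<Rightarrow> 'a) \<Rightarrow> bool" where
  "right_prequasifield circ \<longleftrightarrow>
     quasigroup_on (UNIV - {0}) circ \<and>
     (\<forall>x y z. circ (x + y) z = circ x z + circ y z) \<and>
     (\<forall>x. circ x 0 = 0)"

definition transpose_mult ::
    "nat \<Rightarrow> ('a :: finite_field \<Rightarrow> 'a \<Rightarrow> 'a) \<Rightarrow> 'a \<Rightarrow> 'a \<Rightarrow> 'a" where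
  "transpose_mult m circ x z =
     (THE w. \<forall>y. abs_trace m (w * y) = abs_trace m (x * circ y z))"


subsection \<open>The affine plane over a prequasifield and line ovals\<close>

definition vert_line :: "'a \<Rightarrow> ('a \<times> 'a) set" where
  "vert_line c = {(c, y) | y. True}"

text \<open>The line \<open>y = x \<star> b + a\<close>.\<close>

definition slope_line ::
    "('a :: field \<Rightarrow> 'a \<Rightarrow> 'a) \<Rightarrow> 'a \<Rightarrow> 'a \<Rightarrow> ('a \<times> 'a) set" where
  "slope_line star b a = {(x, star x b + a) | x. True}"

definition plane_lines :: "('a :: field \<Rightarrow> 'a \<Rightarrow> 'a) \<Rightarrow> ('a \<times> 'a) set set" where
  "plane_lines star = {vert_line c | c. True} \<union> {slope_line star b a | b a. True}"

definition parallel_lines ::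
    "('a :: field \<Rightarrow> 'a \<Rightarrow> 'a) \<Rightarrow> ('a \<times> 'a) set \<Rightarrow> ('a \<times> 'a) set \<Rightarrow> bool" where
  "parallel_lines star L M \<longleftrightarrow>
     (\<exists>c c'. L = vert_line c \<and> M = vert_line c') \<or>
     (\<exists>b a a'. L = slope_line star b a \<and> M = slope_line star b a')"

definition line_oval :: "('a :: finite_field \<Rightarrow> 'a \<Rightarrow> 'a) \<Rightarrow> ('a \<times> 'a) set set \<Rightarrow> bool" where
  "line_oval star Ov \<longleftrightarrow>
     Ov \<subseteq> plane_lines star \<and>
     card Ov = CARD('a) + 1 \<and>
     (\<forall>L\<in>Ov. \<forall>M\<in>Ov. L \<noteq> M \<longrightarrow> \<not> parallel_lines star L M) \<and>
     (\<forall>L\<in>Ov. \<forall>M\<in>Ov. \<forall>N\<in>Ov. L \<noteq> M \<and> L \<noteq> N \<and> M \<noteq> N \<longrightarrow> L \<inter> M \<inter> N = {})"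

definition covered_points :: "('a \<times> 'a) set set \<Rightarrow> ('a \<times> 'a) set" where
  "covered_points Ov = {p. \<exists>L\<in>Ov. p \<in> L}"


subsection \<open>Bent functions\<close>

definition walsh :: "nat \<Rightarrow> ('a :: finite_field \<times> 'a \<Rightarrow> bit) \<Rightarrow> 'a \<Rightarrow> 'a \<Rightarrow> int" where
  "walsh m f a b =
     (\<Sum>x\<in>UNIV. \<Sum>y\<in>UNIV. (-1) ^ of_bit (f (x, y) + abs_trace m (a * x + b * y)))"

definition bent :: "nat \<Rightarrow> ('a :: finite_field \<times> 'a \<Rightarrow> bit) \<Rightarrow> bool" where
  "bent m f \<longleftrightarrow>
     (\<forall>a b. walsh m f a b = int CARD('a) \<or> walsh m f a b = - int CARD('a))"

text \<open>Only meaningful for bent \<open>f\<close>; see \<open>bent_dual_spec\<close> below.\<close>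

definition bent_dual ::
    "nat \<Rightarrow> ('a :: finite_field \<times> 'a \<Rightarrow> bit) \<Rightarrow> 'a \<times> 'a \<Rightarrow> bit" where
  "bent_dual m f p =
     (THE t. walsh m f (fst p) (snd p) = (-1) ^ of_bit t * int CARD('a))"

definition two_to_one :: "('a :: finite \<Rightarrow> 'b) \<Rightarrow> bool" where
  "two_to_one h \<longleftrightarrow> (\<forall>w. card {z. h z = w} = 0 \<or> card {z. h z = w} = 2)"


subsection \<open>The definite descriptions above are well defined\<close>

lemma bent_dual_spec:
  fixes f :: "'a :: finite_field \<times> 'a \<Rightarrow> bit"
  assumes "bent m f"
  shows "walsh m f a b = (-1) ^ of_bit (bent_dual m f (a, b)) * int CARD('a)"
proof -
  let ?P = "\<lambda>t :: bit. walsh m f a b = (-1) ^ of_bit t * int CARD('a)"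
  have pos: "int CARD('a) > 0" by (simp add: finite_UNIV_card_ge_0)
  have "?P 0 \<or> ?P 1" using assms by (auto simp: bent_def)
  moreover have "\<not> (?P 0 \<and> ?P 1)" using pos by auto
  moreover have "s = t" if "?P s" "?P t" for s t
    using that calculation(2) by (cases s; cases t) simp_all
  ultimately have "\<exists>!t. ?P t" by blast
  from theI'[OF this] show ?thesis by (simp add: bent_dual_def)
qed

lemma right_prequasifield_ex1:
  assumes "right_prequasifield circ" "x \<noteq> 0"
  shows "\<exists>!z. circ x z = y"
proof -
  from assms(1) have qg: "quasigroup_on (UNIV - {0}) circ" and c0: "circ x 0 = 0"
    unfolding right_prequasifield_def by blast+
  have x: "x \<in> UNIV - {0}" using assms(2) by simp
  have nz: "circ x z \<noteq> 0" if "z \<noteq> 0" for z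
    using qg[unfolded quasigroup_on_def, THEN conjunct1, rule_format, OF x, of z] that by simp
  have ex: "\<exists>!z. z \<in> UNIV - {0} \<and> circ x z = y" if "y \<noteq> 0"
    using qg[unfolded quasigroup_on_def, THEN conjunct2, rule_format, OF x, of y] that by simp
  show ?thesis
  proof (cases "y = 0")
    case True
    show ?thesis
    proof (rule ex1I[of _ 0])
      show "circ x 0 = y" using c0 True by simp
      show "z = 0" if "circ x z = y" for z using nz[of z] that True by (cases "z = 0") simp_all
    qed
  next
    case False
    obtain z where z: "circ x z = y"
      and uniq: "\<forall>z'. z' \<noteq> 0 \<and> circ x z' = y \<longrightarrow> z' = z"
      using ex[OF False] unfolding Ex1_def by auto
    show ?thesis
    proof (rule ex1I[of _ z])
      fix z' assume z': "circ x z' = y"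
      with c0 False have "z' \<noteq> 0" by auto
      with z' uniq show "z' = z" by simp
    qed (fact z)
  qed
qed

lemma char_two:
  assumes "CARD('a :: finite_field) = 2 ^ m"
  shows "CHAR('a) = 2"
proof -
  have "CHAR('a) dvd 2 ^ m" using CHAR_dvd_CARD[where 'a = 'a] assms by simp
  then have "CHAR('a) dvd 2" using CHAR_prime prime_dvd_power by blast
  then show ?thesis using CHAR_prime primes_dvd_imp_eq two_is_prime_nat by blast
qed

lemma of_bit_inj: "of_bit s = (of_bit t :: 'a :: zero_neq_one) \<longleftrightarrow> s = t"
  by (cases s; cases t) simp_all

lemma of_bit_abs_trace:
  fixes x :: "'a :: finite_field"
  assumes card: "CARD('a) = 2 ^ m"
  shows "of_bit (abs_trace m x) = (\<Sum>i<m. x ^ (2 ^ i))"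
proof -
  let ?s = "\<Sum>i<m. x ^ (2 ^ i)"
  have q: "x ^ (2 ^ m) = x"
    using finite_field_power_card_eq_same[of x] card by simp
  have "?s ^ 2 = (\<Sum>i<m. (x ^ (2 ^ i)) ^ 2)"
    by (rule freshmans_dream_sum) (simp_all add: char_two[OF card])
  also have "\<dots> = (\<Sum>i<m. x ^ (2 ^ Suc i))"
    by (simp add: power_mult[symmetric] mult.commute)
  also have "\<dots> = ?s"
    using sum.lessThan_Suc_shift[of "\<lambda>i. x ^ (2 ^ i)" m]
      sum.lessThan_Suc[of "\<lambda>i. x ^ (2 ^ i)" m] q by simp
  finally have "?s * (?s - 1) = 0"
    by (simp add: power2_eq_square algebra_simps)
  then have "?s = of_bit 0 \<or> ?s = of_bit 1" by auto
  then have "\<exists>!t. of_bit t = ?s" using of_bit_inj by metis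
  from theI'[OF this] show ?thesis by (simp add: abs_trace_def)
qed

lemma of_bit_add_char_two:
  assumes "CHAR('a :: finite_field) = 2"
  shows "(of_bit (s + t) :: 'a) = of_bit s + of_bit t"
proof -
  have "(1 :: 'a) + 1 = 0" using of_nat_CHAR[where 'a = 'a] assms by simp
  then show ?thesis by (cases s; cases t) simp_all
qed

lemma abs_trace_add:
  fixes x y :: "'a :: finite_field"
  assumes card: "CARD('a) = 2 ^ m"
  shows "abs_trace m (x + y) = abs_trace m x + abs_trace m y"
proof -
  have "(of_bit (abs_trace m (x + y)) :: 'a) = of_bit (abs_trace m x + abs_trace m y)"
    unfolding of_bit_add_char_two[OF char_two[OF card]] of_bit_abs_trace[OF card]
      sum.distrib[symmetric]
    by (rule sum.cong) (auto intro: freshmans_dream' simp: char_two[OF card])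
  then show ?thesis unfolding of_bit_inj .
qed

lemma abs_trace_nonzero:
  assumes card: "CARD('a :: finite_field) = 2 ^ m" and m: "m \<ge> 1"
  shows "\<exists>x :: 'a. abs_trace m x \<noteq> 0"
proof (rule ccontr)
  assume "\<not> ?thesis"
  then have z: "(\<Sum>i<m. x ^ (2 ^ i)) = 0" for x :: 'a
    using of_bit_abs_trace[OF card, of x] by auto
  define p :: "'a poly" where "p = (\<Sum>i<m. monom 1 (2 ^ i))"
  have "coeff p (2 ^ 0) = (\<Sum>i<m. if i = 0 then 1 else 0)"
    unfolding p_def coeff_sum by (rule sum.cong) auto
  then have p: "p \<noteq> 0" using m by auto
  have "degree p \<le> 2 ^ (m - 1)"
    unfolding p_def
  proof (intro degree_sum_le)
    fix i assume "i \<in> {..<m}"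
    then have "(2 :: nat) ^ i \<le> 2 ^ (m - 1)" by (intro power_increasing) auto
    then show "degree (monom (1 :: 'a) (2 ^ i)) \<le> 2 ^ (m - 1)"
      by (simp add: degree_monom_eq)
  qed auto
  also have "(2 :: nat) ^ (m - 1) < 2 ^ m" using m by (intro power_strict_increasing) auto
  finally have "degree p < CARD('a)" using card by simp
  moreover have "{x. poly p x = 0} = UNIV"
    by (auto simp: p_def poly_sum poly_monom z)
  ultimately show False using card_poly_roots_bound[OF p] by simp
qed

lemma sign_add:
  "(-1 :: int) ^ of_bit (s + t) = (-1) ^ of_bit s * (-1) ^ of_bit t"
  by (cases s; cases t) simp_all

lemma sum_sign_additive:
  fixes psi :: "'a :: finite_field \<Rightarrow> bit"
  assumes add: "\<And>x y. psi (x + y) = psi x + psi y" and x0: "psi x0 \<noteq> 0"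
  shows "(\<Sum>x\<in>UNIV. (-1 :: int) ^ of_bit (psi x)) = 0"
proof -
  let ?S = "\<Sum>x\<in>UNIV. (-1 :: int) ^ of_bit (psi x)"
  have "?S = (\<Sum>x\<in>UNIV. (-1 :: int) ^ of_bit (psi (x0 + x)))"
    by (rule sum.reindex_bij_witness[of _ "\<lambda>x. x0 + x" "\<lambda>x. x - x0"]) auto
  also have "\<dots> = (-1) ^ of_bit (psi x0) * ?S"
    unfolding add sign_add sum_distrib_left ..
  also have "\<dots> = - ?S" using x0 by simp
  finally show ?thesis by simp
qed

lemma additive_eq_trace_form:
  fixes phi :: "'a :: finite_field \<Rightarrow> bit"
  assumes card: "CARD('a) = 2 ^ m" and m: "m \<ge> 1"
    and add: "\<And>x y. phi (x + y) = phi x + phi y"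
  shows "\<exists>!w. \<forall>y. abs_trace m (w * y) = phi y"
proof -
  let ?e = "\<lambda>t :: bit. (-1 :: int) ^ of_bit t"
  note tadd = abs_trace_add[OF card]
  obtain t0 :: 'a where t0: "abs_trace m t0 \<noteq> 0"
    using abs_trace_nonzero[OF card m] by blast
  have phi0: "phi 0 = 0" using add[of 0 0] by (metis add_cancel_right_right add_0)
  have tr0: "abs_trace m (0 :: 'a) = 0"
    using tadd[of 0 0] by (metis add_cancel_right_right add_0)
  have inner: "(\<Sum>u\<in>UNIV. ?e (abs_trace m (u * x))) = (if x = 0 then int CARD('a) else 0)"
    for x :: 'a
  proof (cases "x = 0")
    case False
    have "(\<Sum>u\<in>UNIV. ?e (abs_trace m (u * x))) = 0"
      by (rule sum_sign_additive[where ?x0.0 = "t0 / x"])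
         (use False t0 in \<open>simp_all only: distrib_right tadd, simp\<close>)
    with False show ?thesis by simp
  qed (simp add: tr0)
  have "(\<Sum>u\<in>UNIV. \<Sum>x\<in>UNIV. ?e (phi x + abs_trace m (u * x))) =
        (\<Sum>x\<in>UNIV. ?e (phi x) * (\<Sum>u\<in>UNIV. ?e (abs_trace m (u * x))))"
    by (subst sum.swap) (simp only: sign_add sum_distrib_left)
  also have "\<dots> = (\<Sum>x\<in>(UNIV :: 'a set). if x = 0 then int CARD('a) else 0)"
    unfolding inner by (rule sum.cong) (auto simp: phi0)
  also have "\<dots> \<noteq> 0" by (simp add: finite_UNIV_card_ge_0)
  finally obtain u where u: "(\<Sum>x\<in>UNIV. ?e (phi x + abs_trace m (u * x))) \<noteq> 0"
    by (meson sum.not_neutral_contains_not_neutral)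
  have "phi x + abs_trace m (u * x) = 0" for x
  proof (rule ccontr)
    assume nz: "phi x + abs_trace m (u * x) \<noteq> 0"
    have "(\<Sum>x\<in>UNIV. ?e (phi x + abs_trace m (u * x))) = 0"
      by (rule sum_sign_additive[where psi = "\<lambda>x. phi x + abs_trace m (u * x)", OF _ nz])
         (simp only: add distrib_left tadd ac_simps)
    with u show False by blast
  qed
  then have ex: "\<forall>y. abs_trace m (u * y) = phi y"
    by (metis add_eq_0_iff uminus_bit_def id_apply)
  moreover have "w = u" if w: "\<forall>y. abs_trace m (w * y) = phi y" for w
  proof (rule ccontr)
    assume "w \<noteq> u"
    then have "abs_trace m (w * (t0 / (w - u))) =
        abs_trace m t0 + abs_trace m (u * (t0 / (w - u)))"
      unfolding tadd[symmetric] by (simp add: field_simps)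
    then have "abs_trace m t0 = 0"
      unfolding w[rule_format] ex[rule_format] by (metis add_cancel_left_left)
    with t0 show False by blast
  qed
  ultimately show ?thesis by blast
qed

lemma transpose_mult_spec:
  fixes circ :: "'a :: finite_field \<Rightarrow> 'a \<Rightarrow> 'a"
  assumes card: "CARD('a) = 2 ^ m" and m: "m \<ge> 1" and Q: "right_prequasifield circ"
  shows "abs_trace m (transpose_mult m circ x z * y) = abs_trace m (x * circ y z)"
proof -
  have "\<exists>!w. \<forall>y. abs_trace m (w * y) = abs_trace m (x * circ y z)"
    using Q
    by (intro additive_eq_trace_form[OF card m])
       (simp only: right_prequasifield_def distrib_left abs_trace_add[OF card])
  from theI'[OF this] show ?thesis by (simp add: transpose_mult_def)
qed

end

theory Submission
  imports Defs
begin

text \<open>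
  Substituting \<open>y = x \<circ> z\<close> for \<open>x \<noteq> 0\<close> and moving \<open>\<circ>\<close> to \<open>\<star>\<close> by means of the trace form, the
  Walsh transform becomes a character sum in \<open>x\<close> and equals \<open>q ([b = 0] + N - 1)\<close>, where \<open>N\<close>
  is the number of solutions \<open>z\<close> of \<open>b \<star> z + G z = a\<close>, that is, the number of sloped lines of
  \<open>\<O>\<close> through the point \<open>(b, a)\<close>. Bentness thus says \<open>N = 1\<close> for \<open>b = 0\<close> and \<open>N \<in> {0, 2}\<close>
  for \<open>b \<noteq> 0\<close>. For a line oval, \<open>N \<le> 2\<close> is immediate, and \<open>N \<noteq> 1\<close> because a sloped line of
  \<open>\<O>\<close> meets the \<open>q - 1\<close> other ones in \<open>q - 1\<close> distinct points off the line \<open>x = 0\<close>, which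
  exhausts its points there.
\<close>

section \<open>Characteristic two, the trace form and the transposed multiplication\<close>

lemma add_eq_0_iff_char_two:
  assumes "CHAR('a :: finite_field) = 2"
  shows "x + y = 0 \<longleftrightarrow> x = (y :: 'a)"
proof -
  have "(1 :: 'a) + 1 = 0" using of_nat_CHAR[where 'a = 'a] assms by simp
  then have "y + y = 0" using distrib_left[of y 1 1] by simp
  then show ?thesis by (metis add_right_cancel)
qed

locale transposed_prequasifield =
  fixes m :: nat and circ :: "'a :: finite_field \<Rightarrow> 'a \<Rightarrow> 'a"
  assumes m_pos: "m \<ge> 1" and card_eq: "CARD('a) = 2 ^ m"
    and prequasifield: "right_prequasifield circ"
begin

abbreviation star :: "'a \<Rightarrow> 'a \<Rightarrow> 'a" where
  "star \<equiv> transpose_mult m circ"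

abbreviation tr :: "'a \<Rightarrow> bit" where
  "tr \<equiv> abs_trace m"

lemmas tr_add = abs_trace_add[OF card_eq]
  and tr_star = transpose_mult_spec[OF card_eq m_pos prequasifield]
  and add_eq_0 = add_eq_0_iff_char_two[OF char_two[OF card_eq]]
  and circ_ex1 = right_prequasifield_ex1[OF prequasifield]

lemma tr_0 [simp]: "tr 0 = 0"
  using tr_add[of 0 0] by (metis add_cancel_right_right add_0)

lemma tr_form_nondegenerate:
  assumes "\<And>y. tr (u * y) = tr (v * y)"
  shows "u = v"
proof -
  have "\<exists>!w. \<forall>y. tr (w * y) = tr (v * y)"
    by (rule additive_eq_trace_form[OF card_eq m_pos]) (simp add: distrib_left tr_add)
  with assms show ?thesis by blast
qed

lemma circ_add: "circ (x + y) z = circ x z + circ y z"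
  using prequasifield by (simp add: right_prequasifield_def)

lemma circ_left_cancel:
  assumes "x \<noteq> 0"
  shows "circ x z = circ x z' \<longleftrightarrow> z = z'"
  using circ_ex1[OF assms, of "circ x z'"] by auto

lemma bij_circ:
  assumes "x \<noteq> 0"
  shows "bij (circ x)"
  unfolding bij_iff using circ_ex1[OF assms] by blast

lemma star_add: "star (x + y) z = star x z + star y z"
  by (rule tr_form_nondegenerate) (simp only: tr_star tr_add distrib_right)

lemma star_0 [simp]: "star 0 z = 0"
  using star_add[of 0 0 z] by (metis add_cancel_right_right add_0)

text \<open>By left cancellation in \<open>circ\<close> the additive map \<open>h\<close> is
  injective, hence onto. The map in question is its adjoint for the trace form, so it is injective
  too. Geometrically, lines of distinct slopes meet exactly once.\<close>

lemma star_diff_bij: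
  assumes "z \<noteq> z'"
  shows "bij (\<lambda>x. star x z + star x z')"
proof -
  define h where "h y = circ y z + circ y z'" for y
  have h_add: "h (x + y) = h x + h y" for x y
    by (simp add: h_def circ_add ac_simps)
  have "inj h"
  proof (rule injI)
    fix x y assume "h x = h y"
    then have "h (x + y) = 0" by (simp only: h_add add_eq_0)
    then have "circ (x + y) z = circ (x + y) z'" by (simp add: h_def add_eq_0)
    with assms circ_left_cancel have "x + y = 0" by blast
    then show "x = y" by (simp add: add_eq_0)
  qed
  then have "surj h" by (simp add: finite_UNIV_inj_surj)
  have "inj (\<lambda>x. star x z + star x z')"
  proof (rule injI)
    fix x y assume eq: "star x z + star x z' = star y z + star y z'"
    have "tr (x * h w) = tr (y * h w)" for w
      using arg_cong[OF eq, of "\<lambda>u. tr (u * w)"]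
      by (simp add: h_def distrib_left distrib_right tr_add tr_star)
    with \<open>surj h\<close> have "tr (x * w) = tr (y * w)" for w by (metis surjD)
    then show "x = y" by (rule tr_form_nondegenerate)
  qed
  then show ?thesis by (simp add: bij_def finite_UNIV_inj_surj)
qed

text \<open>Orthogonality: every nonzero \<open>u\<close> gives a nontrivial additive
  character.\<close>

lemma sum_sign_tr:
  "(\<Sum>x\<in>UNIV. (-1 :: int) ^ of_bit (tr (u * x))) = (if u = 0 then int CARD('a) else 0)"
proof (cases "u = 0")
  case False
  obtain t where "tr t \<noteq> 0" using abs_trace_nonzero[OF card_eq m_pos] by blast
  with False have "tr (u * (t / u)) \<noteq> 0" by simp
  with False show ?thesis
    by (simp only: sum_sign_additive[where psi = "\<lambda>x. tr (u * x)"] distrib_left tr_add if_False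
        not_False_eq_True)
qed simp

end

section \<open>The Walsh transform of \<open>f\<close> and solution counts\<close>

locale prequasifield_function = transposed_prequasifield m circ
  for m :: nat and circ :: "'a :: finite_field \<Rightarrow> 'a \<Rightarrow> 'a" +
  fixes G :: "'a \<Rightarrow> 'a" and f :: "'a \<times> 'a \<Rightarrow> bit"
  assumes f_0: "\<And>y. f (0, y) = 0"
    and f_nz: "\<And>x y. x \<noteq> 0 \<Longrightarrow> f (x, y) = tr (G (THE z. circ x z = y) * x)"
begin

text \<open>Arguments in the order of \<open>walsh\<close>, so that \<open>solutions a b\<close>
  belongs to the point \<open>(b, a)\<close>.\<close>

definition solutions :: "'a \<Rightarrow> 'a \<Rightarrow> 'a set" where
  "solutions a b = {z. G z + star b z = a}"

lemma walsh_eq: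
  "walsh m f a b =
     int CARD('a) * ((if b = 0 then 1 else 0) + int (card (solutions a b)) - 1)"
proof -
  let ?q = "int CARD('a)"
  let ?e = "\<lambda>t :: bit. (-1 :: int) ^ of_bit t"
  let ?T = "\<lambda>x. \<Sum>z\<in>UNIV. ?e (tr ((G z + a + star b z) * x))"
  have nz: "(\<Sum>y\<in>UNIV. ?e (f (x, y) + tr (a * x + b * y))) = ?T x" if "x \<noteq> 0" for x
  proof -
    have "f (x, circ x z) = tr (G z * x)" for z
      using that by (simp add: f_nz circ_left_cancel)
    then have "?e (f (x, circ x z) + tr (a * x + b * circ x z)) =
        ?e (tr ((G z + a + star b z) * x))" for z
      by (simp add: tr_add tr_star distrib_right add.assoc)
    then show ?thesis
      by (subst sum.reindex_bij_betw[OF bij_circ[OF that], symmetric]) (simp only:)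
  qed
  have at_0: "(\<Sum>y\<in>UNIV. ?e (f (0, y) + tr (a * 0 + b * y))) =
      ?T 0 + (?q * (if b = 0 then 1 else 0) - ?q)"
    using sum_sign_tr[of b] by (simp add: f_0)
  have "walsh m f a b =
      (\<Sum>x\<in>UNIV. ?T x + (if x = 0 then ?q * (if b = 0 then 1 else 0) - ?q else 0))"
    unfolding walsh_def using nz at_0 by (intro sum.cong) auto
  also have "\<dots> = (\<Sum>x\<in>UNIV. ?T x) + (?q * (if b = 0 then 1 else 0) - ?q)"
    by (simp add: sum.distrib)
  \<comment> \<open>Summing over \<open>x\<close> first leaves a full character sum for each
    \<open>z\<close>.\<close>
  also have "(\<Sum>x\<in>UNIV. ?T x) =
      (\<Sum>z\<in>UNIV. if G z + a + star b z = 0 then ?q else 0)"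
    by (subst sum.swap) (simp only: sum_sign_tr)
  also have "\<dots> = (\<Sum>z\<in>UNIV. if z \<in> solutions a b then ?q else 0)"
  proof (intro sum.cong refl if_cong)
    fix z
    have "G z + a + star b z = (G z + star b z) + a" by (simp add: ac_simps)
    then show "G z + a + star b z = 0 \<longleftrightarrow> z \<in> solutions a b"
      by (simp only: solutions_def add_eq_0 mem_Collect_eq)
  qed
  also have "\<dots> = ?q * int (card (solutions a b))"
    by (simp add: sum.If_cases)
  finally show ?thesis by (simp add: algebra_simps)
qed

text \<open>Dividing by the field size leaves the bracket of \<open>walsh_eq\<close>, which must be
  1 or -1. For \<open>b = 0\<close> it is the count itself, so -1 is impossible; otherwise it is the
  count minus 1.\<close>

lemma bent_iff_card_solutions:
  "bent m f \<longleftrightarrow> (\<forall>a. card (solutions a 0) = 1) \<and>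
     (\<forall>a b. b \<noteq> 0 \<longrightarrow> card (solutions a b) = 0 \<or> card (solutions a b) = 2)"
proof -
  let ?N = "\<lambda>a b. card (solutions a b)"
  have q: "int CARD('a) \<noteq> 0" by simp
  have "walsh m f a b = int CARD('a) \<or> walsh m f a b = - int CARD('a) \<longleftrightarrow>
      (if b = 0 then ?N a b = 1 else ?N a b = 0 \<or> ?N a b = 2)" for a b
  proof -
    define k where "k = (if b = 0 then 1 else 0) + int (?N a b) - 1"
    have "walsh m f a b = int CARD('a) \<or> walsh m f a b = - int CARD('a) \<longleftrightarrow> k = 1 \<or> k = - 1"
      unfolding walsh_eq k_def[symmetric]
      using q mult_cancel_left[of "int CARD('a)" k 1] mult_cancel_left[of "int CARD('a)" k "-1"]
      by simp
    then show ?thesis unfolding k_def by auto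
  qed
  then show ?thesis unfolding bent_def by (simp only:) metis
qed

lemma bij_iff_card_solutions: "bij G \<longleftrightarrow> (\<forall>a. card (solutions a 0) = 1)"
proof -
  have "(\<exists>!z. G z = a) \<longleftrightarrow> card (solutions a 0) = 1" for a
    unfolding One_nat_def card_1_singleton_iff by (simp add: solutions_def set_eq_iff) metis
  then show ?thesis by (simp add: bij_iff)
qed

lemma bent_iff_two_to_one:
  "bent m f \<longleftrightarrow> bij G \<and> (\<forall>b. b \<noteq> 0 \<longrightarrow> two_to_one (\<lambda>z. G z + star b z))"
  unfolding bent_iff_card_solutions bij_iff_card_solutions two_to_one_def solutions_def
  by blast

section \<open>The lines of \<open>oval\<close>, their concurrency, and bentness\<close>

definition sloped :: "'a \<Rightarrow> ('a \<times> 'a) set" where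
  "sloped z = slope_line star z (G z)"

definition oval :: "('a \<times> 'a) set set" where
  "oval = insert (vert_line 0) (range sloped)"

lemma mem_vert_line: "(x, y) \<in> vert_line c \<longleftrightarrow> x = c"
  by (auto simp: vert_line_def)

lemma mem_sloped: "(x, y) \<in> sloped z \<longleftrightarrow> z \<in> solutions y x"
  by (auto simp: sloped_def slope_line_def solutions_def add.commute)

lemma slope_line_neq_vert_line: "slope_line star z a \<noteq> vert_line c"
proof
  assume "slope_line star z a = vert_line c"
  \<comment> \<open>A sloped line has a point over every abscissa; any one other than
    \<open>c\<close> serves.\<close>
  moreover have "(c + 1, star (c + 1) z + a) \<in> slope_line star z a"
    by (auto simp: slope_line_def)
  ultimately show False by (simp add: mem_vert_line)
qed

text \<open>The points over 0 equate the intercepts, so the map of \<open>star_diff_bij\<close>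
  vanishes identically, which is impossible for distinct slopes.\<close>

lemma slope_line_slope_unique:
  assumes "slope_line star z a = slope_line star z' a'"
  shows "z = z'"
proof -
  have eq: "star x z + a = star x z' + a'" for x
    using assms by (auto simp: slope_line_def set_eq_iff)
  from eq[of 0] have "a = a'" by simp
  with eq have "star x z + star x z' = 0" for x unfolding add_eq_0 by simp
  then have "\<not> inj (\<lambda>x. star x z + star x z')"
    using zero_neq_one[where 'a = 'a] unfolding inj_def by metis
  then show ?thesis using star_diff_bij bij_is_inj by blast
qed

lemma inj_sloped: "inj sloped"
  by (rule injI) (metis sloped_def slope_line_slope_unique)

lemma sloped_neq_vert_line: "sloped z \<noteq> vert_line c"
  by (simp add: sloped_def slope_line_neq_vert_line)

lemma card_oval: "card oval = CARD('a) + 1"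
proof -
  have "vert_line 0 \<notin> range sloped" using sloped_neq_vert_line by (metis imageE)
  then show ?thesis by (simp add: oval_def card_image[OF inj_sloped])
qed

lemma oval_subset_plane_lines: "oval \<subseteq> plane_lines star"
  by (auto simp: oval_def plane_lines_def sloped_def)

text \<open>Each parallel class contributes a single line: \<open>vert_line 0\<close> for the
  verticals, \<open>sloped b\<close> for slope \<open>b\<close>.\<close>

lemma oval_not_parallel:
  assumes "L \<in> oval" "M \<in> oval" "L \<noteq> M"
  shows "\<not> parallel_lines star L M"
proof
  assume "parallel_lines star L M"
  then consider c c' where "L = vert_line c" "M = vert_line c'"
    | b a a' where "L = slope_line star b a" "M = slope_line star b a'"
    unfolding parallel_lines_def by blast
  then show False
  proof cases
    case 1
    with assms sloped_neq_vert_line show False by (auto simp: oval_def)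
  next
    case 2
    have "K = sloped b" if "K \<in> oval" "K = slope_line star b c" for K c
    proof -
      from that slope_line_neq_vert_line obtain z where z: "K = sloped z"
        unfolding oval_def by auto
      with that have "b = z" by (metis sloped_def slope_line_slope_unique)
      with z show ?thesis by simp
    qed
    with assms 2 show False by blast
  qed
qed

text \<open>Size and parallelism are right for every \<open>G\<close>, which leaves only
  concurrency.\<close>

lemma line_oval_iff_not_concurrent:
  "line_oval star oval \<longleftrightarrow>
     (\<forall>L\<in>oval. \<forall>M\<in>oval. \<forall>N\<in>oval. L \<noteq> M \<and> L \<noteq> N \<and> M \<noteq> N \<longrightarrow> L \<inter> M \<inter> N = {})"
  by (simp add: line_oval_def card_oval oval_subset_plane_lines oval_not_parallel)

text \<open>Concurrent triples are of two types. One containing \<open>vert_line 0\<close> meets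
  over 0, where \<open>star 0 z = 0\<close>, and exists exactly when \<open>G\<close> repeats a
  value. The others consist of three sloped lines.\<close>

lemma line_oval_iff_solutions:
  "line_oval star oval \<longleftrightarrow> inj G \<and>
     (\<forall>a b z1 z2 z3. {z1, z2, z3} \<subseteq> solutions a b \<longrightarrow> z1 = z2 \<or> z1 = z3 \<or> z2 = z3)"
  (is "?lhs \<longleftrightarrow> inj G \<and> ?R")
proof
  assume ?lhs
  then have conc: "L = M \<or> L = N \<or> M = N"
    if "L \<in> oval" "M \<in> oval" "N \<in> oval" "p \<in> L" "p \<in> M" "p \<in> N" for L M N p
    using that unfolding line_oval_iff_not_concurrent by blast
  have "inj G"
  proof (rule injI)
    fix z z' assume "G z = G z'"
    then show "z = z'"
      using conc[of "vert_line 0" "sloped z" "sloped z'" "(0, G z)"]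
        sloped_neq_vert_line sloped_neq_vert_line[symmetric] injD[OF inj_sloped]
      by (auto simp: oval_def mem_vert_line mem_sloped solutions_def)
  qed
  moreover have ?R
  proof (intro allI impI)
    fix a b z1 z2 z3 assume "{z1, z2, z3} \<subseteq> solutions a b"
    then show "z1 = z2 \<or> z1 = z3 \<or> z2 = z3"
      using conc[of "sloped z1" "sloped z2" "sloped z3" "(b, a)"] injD[OF inj_sloped]
      by (auto simp: oval_def mem_sloped)
  qed
  ultimately show "inj G \<and> ?R" ..
next
  assume R: "inj G \<and> ?R"
  then have inj: "z = z'" if "z \<in> solutions a 0" "z' \<in> solutions a 0" for z z' a
    using that R unfolding solutions_def inj_def by auto
  show ?lhs
    unfolding line_oval_iff_not_concurrent
  proof (intro ballI impI equals0I)
    fix L M N p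
    assume LMN: "L \<in> oval" "M \<in> oval" "N \<in> oval" "L \<noteq> M \<and> L \<noteq> N \<and> M \<noteq> N"
      and p: "p \<in> L \<inter> M \<inter> N"
    obtain b a where [simp]: "p = (b, a)" by fastforce
    have through: "K = vert_line 0 \<and> b = 0 \<or> (\<exists>z\<in>solutions a b. K = sloped z)"
      if "K \<in> oval" "p \<in> K" for K
      using that by (auto simp: oval_def mem_sloped mem_vert_line)
    have "z = z' \<or> z = z''" if "z \<in> solutions a b" "z' \<in> solutions a b" "z'' \<in> solutions a b"
      "z' \<noteq> z''" for z z' z''
      using that R by blast
    with LMN p through[of L] through[of M] through[of N] inj show False by (smt (verit) IntD1 IntD2)
  qed
qed

lemma line_oval_solutions_ge_2:
  assumes "line_oval star oval" "b \<noteq> 0" "z \<in> solutions a b"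
  shows "\<exists>z'. z' \<noteq> z \<and> z' \<in> solutions a b"
proof -
  from assms(1) have inj: "inj G"
    and conc: "\<And>a b z1 z2 z3. {z1, z2, z3} \<subseteq> solutions a b \<Longrightarrow> z1 = z2 \<or> z1 = z3 \<or> z2 = z3"
    unfolding line_oval_iff_solutions by blast+
  have "\<exists>x. G z + star x z = G w + star x w" if w: "w \<noteq> z" for w
  proof -
    obtain x where "star x z + star x w = G z + G w"
      using bij_is_surj[OF star_diff_bij[of z w]] w unfolding surj_def by metis
    then have "(G z + star x z) + (G w + star x w) = (G z + G w) + (G z + G w)"
      by (simp add: ac_simps)
    then have "(G z + star x z) + (G w + star x w) = 0"
      using add_eq_0 by metis
    then show ?thesis using add_eq_0 by blast
  qed
  \<comment> \<open>\<open>X w\<close> is an abscissa at which \<open>sloped z\<close> and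
    \<open>sloped w\<close> meet.\<close>
  then obtain X where X: "G z + star (X w) z = G w + star (X w) w" if "w \<noteq> z" for w
    by metis
  \<comment> \<open>Equal abscissas would put three sloped lines through one point of
    \<open>sloped z\<close>.\<close>
  have "inj_on X (UNIV - {z})"
  proof (rule inj_onI)
    fix u w assume "u \<in> UNIV - {z}" "w \<in> UNIV - {z}" "X u = X w"
    with X[of u] X[of w] show "u = w"
      using conc[of z u w "G z + star (X u) z" "X u"] by (auto simp: solutions_def)
  qed
  then have card: "card (X ` (UNIV - {z})) = card (UNIV - {0 :: 'a})"
    by (simp only: card_image) simp
  have "X ` (UNIV - {z}) \<subseteq> UNIV - {0}"
  proof -
    \<comment> \<open>A crossing over 0 would make \<open>G\<close> repeat a value.\<close>
    have "X w \<noteq> 0" if "w \<noteq> z" for w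
    proof
      assume "X w = 0"
      then have "G z = G w" using X[OF that] by simp
      with inj that show False by (simp add: inj_eq)
    qed
    then show ?thesis by auto
  qed
  \<comment> \<open>Inclusion and equal size give equality, so some line crosses
    \<open>sloped z\<close> over \<open>b\<close>.\<close>
  with card have "X ` (UNIV - {z}) = UNIV - {0}"
    by (metis card_subset_eq finite)
  then have "b \<in> X ` (UNIV - {z})" using assms(2) by simp
  then obtain w where "w \<noteq> z" "X w = b" by auto
  with X[of w] assms(3) show ?thesis by (auto simp: solutions_def)
qed

text \<open>Bentness bounds every count by 2, which forbids three sloped lines through a point.
  Conversely, non-concurrency bounds the counts by 2, \<open>line_oval_solutions_ge_2\<close>
  excludes 1 off \<open>b = 0\<close>, and the injective \<open>G\<close> is bijective because the
  field is finite.\<close>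

lemma bent_iff_line_oval: "bent m f \<longleftrightarrow> line_oval star oval"
proof
  assume "bent m f"
  then have "bij G" by (simp add: bent_iff_two_to_one)
  have card: "card (solutions a b) \<le> 2" for a b
    using \<open>bent m f\<close> unfolding bent_iff_card_solutions
    by (metis order_refl zero_le one_le_numeral)
  have "z1 = z2 \<or> z1 = z3 \<or> z2 = z3" if "{z1, z2, z3} \<subseteq> solutions a b" for z1 z2 z3 a b
    using card_mono[OF _ that] card[of a b] by (auto simp: card_insert_if split: if_splits)
  with \<open>bij G\<close> show "line_oval star oval"
    unfolding line_oval_iff_solutions bij_def by blast
next
  assume lo: "line_oval star oval"
  then have "bij G"
    by (simp add: line_oval_iff_solutions bij_def finite_UNIV_inj_surj)
  moreover have "card (solutions a b) = 0 \<or> card (solutions a b) = 2" if "b \<noteq> 0" for a b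
  proof (cases "solutions a b = {}")
    case False
    then obtain z where z: "z \<in> solutions a b" by blast
    then obtain z' where z': "z' \<noteq> z" "z' \<in> solutions a b"
      using line_oval_solutions_ge_2[OF lo \<open>b \<noteq> 0\<close>] by blast
    have "w = z \<or> w = z'" if "w \<in> solutions a b" for w
      using lo[unfolded line_oval_iff_solutions, THEN conjunct2, rule_format, of w z z' a b]
        that z z' by auto
    with z z' have "solutions a b = {z, z'}" by blast
    with z' show ?thesis by simp
  qed simp
  ultimately show "bent m f"
    unfolding bent_iff_card_solutions bij_iff_card_solutions by blast
qed

section \<open>The dual of \<open>f\<close>\<close>

lemma covered_iff: "(b, a) \<in> covered_points oval \<longleftrightarrow> b = 0 \<or> solutions a b \<noteq> {}"
  by (auto simp: covered_points_def oval_def mem_vert_line mem_sloped)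

text \<open>The bracket of \<open>walsh_eq\<close> is the sign given by the dual: 1 if
  \<open>b = 0\<close> or two sloped lines pass through \<open>(b, a)\<close>, and -1 if no line
  does.\<close>

lemma bent_dual_eq:
  assumes "bent m f"
  shows "bent_dual m f (a, b) = (if (b, a) \<in> covered_points oval then 0 else 1)"
proof -
  have card: "b = 0 \<Longrightarrow> card (solutions a b) = 1"
    "b \<noteq> 0 \<Longrightarrow> card (solutions a b) = 0 \<or> card (solutions a b) = 2"
    using assms unfolding bent_iff_card_solutions by auto
  have "int CARD('a) \<noteq> 0" by simp
  moreover have "int CARD('a) * ((if b = 0 then 1 else 0) + int (card (solutions a b)) - 1)
      = int CARD('a) * (-1) ^ of_bit (bent_dual m f (a, b))"
    using bent_dual_spec[OF assms, of a b] unfolding walsh_eq by (simp add: mult.commute)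
  ultimately have eq: "(if b = 0 then 1 else 0) + int (card (solutions a b)) - 1 =
      (-1) ^ of_bit (bent_dual m f (a, b))"
    using mult_cancel_left by blast
  show ?thesis
    using eq card by (cases "bent_dual m f (a, b)") (auto simp: covered_iff split: if_splits)
qed

text \<open>Each power is 0 at 0 and 1 elsewhere. The factor in \<open>y\<close> tests
  \<open>vert_line 0\<close> and the factor at \<open>z\<close> tests \<open>sloped z\<close>, for
  arbitrary \<open>G\<close>.\<close>

lemma uncovered_prod:
  "y ^ (CARD('a) - 1) * (\<Prod>z\<in>UNIV. (star y z + x + G z) ^ (CARD('a) - 1)) =
     (if (y, x) \<in> covered_points oval then 0 else 1)"
proof -
  have pow: "u ^ (CARD('a) - 1) = (if u = 0 then 0 else 1)" for u :: 'a
  proof (cases "u = 0")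
    case True
    \<comment> \<open>This makes the exponent positive; \<open>0 ^ 0\<close> would be 1.\<close>
    have "CARD('a) > 1" unfolding card_eq using m_pos by (intro one_less_power) auto
    with True show ?thesis by simp
  next
    case False
    have "u * u ^ (CARD('a) - 1) = u * 1"
      using finite_field_power_card_eq_same[of u]
      by (metis One_nat_def Suc_pred mult.right_neutral power_Suc zero_less_card_finite)
    with False show ?thesis by simp
  qed
  have "star y z + x + G z = 0 \<longleftrightarrow> z \<in> solutions x y" for z
    using add_eq_0[of "G z + star y z" x] by (simp add: solutions_def ac_simps)
  then show ?thesis
    unfolding pow covered_iff by auto
qed

end

theorem theorem4p3:
  fixes m :: nat
    and circ star :: "'a :: finite_field \<Rightarrow> 'a \<Rightarrow> 'a"
    and G :: "'a \<Rightarrow> 'a"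
    and f :: "'a \<times> 'a \<Rightarrow> bit"
    and Ov :: "('a \<times> 'a) set set"
  assumes "m \<ge> 1" and "CARD('a) = 2 ^ m"
    and "right_prequasifield circ"
    and "star = transpose_mult m circ"
    and "\<And>y. f (0, y) = 0"
    and "\<And>x y. x \<noteq> 0 \<Longrightarrow> f (x, y) = abs_trace m (G (THE z. circ x z = y) * x)"
    and "Ov = {vert_line 0} \<union> {slope_line star z (G z) | z. True}"
  shows "(bent m f \<longleftrightarrow> bij G \<and> (\<forall>b. b \<noteq> 0 \<longrightarrow> two_to_one (\<lambda>z. G z + star b z))) \<and>
    (bent m f \<longleftrightarrow> line_oval star Ov) \<and>
    (bent m f \<longrightarrow>
      (\<forall>x y. bent_dual m f (x, y) = 1 + indicator (covered_points Ov) (y, x) \<and>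
             bent_dual m f (x, y) = (if (y, x) \<in> covered_points Ov then 0 else 1) \<and>
             of_bit (bent_dual m f (x, y)) =
               y ^ (CARD('a) - 1) * (\<Prod>z\<in>UNIV. (star y z + x + G z) ^ (CARD('a) - 1))))"
proof -
  interpret prequasifield_function m circ G f
    by unfold_locales fact+
  have star: "star = transpose_mult m circ" by fact
  have Ov: "Ov = oval"
    unfolding assms(7) oval_def sloped_def star by auto
  \<comment> \<open>As \<open>1 + 1 = 0\<close> in \<open>bit\<close>, adding 1 to the indicator
    gives the conditional form of the dual.\<close>
  show ?thesis
    unfolding Ov star
    using bent_iff_two_to_one bent_iff_line_oval bent_dual_eq uncovered_prod
    by (auto simp: indicator_def)
qed

end
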